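(* Let $A$ and $M$ be modular closure spaces, $d\colon A\to M$ a monotone continuous function and $J\colon A\nrightarrow B$ a modular relation into an ordered set $B$. The left Kan extension $l\colon B\to M$ of $d$ along $J$, if it exists, satisfies the Beck–Chevalley condition whenever $M$ is normalised and $d(J^\circ y)\subseteq M$ is compact and up-directed for each $y\in B$.
   Context: An ordered set is a set with a transitive and reflexive relation $\le$. A modular relation $J\colon A\nrightarrow B$ between ordered sets is a relation $J\subseteq A\times B$ such that $x_1\le x_2$, $x_2Jy_1$ and $y_1\le y_2$ imply $x_1Jy_2$. Write $J^\circ y=\{x\in A\mid xJy\}$. A closure space is a set $A$ with an operation $S\mapsto\bar S$ on its subsets such that $S\subseteq\bar S$, $S\subseteq T$ implies $\bar S\subseteq\bar T$, and $\bar{\bar S}=\bar S$; a subset $V$ is closed if $\bar V=V$. A map $f\colon A\to C$ of closure spaces is continuous if $f(\bar S)\subseteq\overline{f(S)}$ for all $S\subseteq A$. A modular closure space is a closure space equipped with an ordering $\le$ (transitive and reflexive) such that $x\le y$ implies $y\in\overline{\{x\}}$; it is normalised if moreover $x\le y$ if and only if $y\in\overline{\{x\}}$, for all $x,y$. A subset $S\subseteq A$ of a closure space is compact if for every family $(V_i)_{i\in I}$ of closed subsets of $A$: if $S\cap\bigcap_{j\in F}V_j\ne\emptyset$ for all finite $F\subseteq I$, then $S\cap\bigcap_{i\in I}V_i\ne\emptyset$. A subset of an ordered set is up-directed if it is non-empty and each of its finite subsets has an upper bound in it. For $d\colon A\to M$ monotone and $J\colon A\nrightarrow B$ a modular relation,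 a monotone map $l\colon B\to M$ is the left Kan extension of $d$ along $J$ if, for each $y\in B$, $ly$ is a supremum of $d(J^\circ y)$, i.e. for all $z\in M$: $ly\le z$ if and only if $dx\le z$ for all $x\in J^\circ y$. It satisfies the Beck–Chevalley condition if for all $z\in M$ and $y\in B$: $z\le ly$ if and only if there is $x\in J^\circ y$ with $z\le dx$ (i.e. the suprema are attained as maxima). *)

theory Defs
  imports Main "HOL-Library.FuncSet"
begin

text \<open>
  All structures live on explicit carrier sets (possibly empty). An order \<open>le\<close> or a closure
  operation \<open>cl\<close> is only constrained on its carrier, respectively on subsets of it.
  Orders need not be antisymmetric.
\<close>

definition ordered_set :: "'a set \<Rightarrow> ('a \<Rightarrow> 'a \<Rightarrow> bool) \<Rightarrow> bool" where
  "ordered_set A le \<longleftrightarrow> reflp_on A le \<and> transp_on A le"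

definition modular_relation ::
  "'a set \<Rightarrow> ('a \<Rightarrow> 'a \<Rightarrow> bool) \<Rightarrow> 'b set \<Rightarrow> ('b \<Rightarrow> 'b \<Rightarrow> bool) \<Rightarrow> ('a \<times> 'b) set \<Rightarrow> bool" where
  "modular_relation A leA B leB J \<longleftrightarrow>
     J \<subseteq> A \<times> B \<and>
     (\<forall>x1\<in>A. \<forall>x2\<in>A. \<forall>y1\<in>B. \<forall>y2\<in>B.
        leA x1 x2 \<and> (x2, y1) \<in> J \<and> leB y1 y2 \<longrightarrow> (x1, y2) \<in> J)"

definition preimage_at :: "'a set \<Rightarrow> ('a \<times> 'b) set \<Rightarrow> 'b \<Rightarrow> 'a set" where
  "preimage_at A J y = {x \<in> A. (x, y) \<in> J}"

definition closure_space :: "'a set \<Rightarrow> ('a set \<Rightarrow> 'a set) \<Rightarrow> bool" where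
  "closure_space A cl \<longleftrightarrow>
     cl \<in> Pow A \<rightarrow> Pow A \<and>
     (\<forall>S. S \<subseteq> A \<longrightarrow> S \<subseteq> cl S) \<and>
     (\<forall>S T. S \<subseteq> T \<and> T \<subseteq> A \<longrightarrow> cl S \<subseteq> cl T) \<and>
     (\<forall>S. S \<subseteq> A \<longrightarrow> cl (cl S) = cl S)"

definition closed_subset :: "'a set \<Rightarrow> ('a set \<Rightarrow> 'a set) \<Rightarrow> 'a set \<Rightarrow> bool" where
  "closed_subset A cl V \<longleftrightarrow> V \<subseteq> A \<and> cl V = V"

definition continuous_map_between ::
  "'a set \<Rightarrow> ('a set \<Rightarrow> 'a set) \<Rightarrow> 'c set \<Rightarrow> ('c set \<Rightarrow> 'c set) \<Rightarrow> ('a \<Rightarrow> 'c) \<Rightarrow> bool" where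
  "continuous_map_between A clA C clC f \<longleftrightarrow>
     f \<in> A \<rightarrow> C \<and> (\<forall>S. S \<subseteq> A \<longrightarrow> f ` clA S \<subseteq> clC (f ` S))"

definition monotone_map_between ::
  "'a set \<Rightarrow> ('a \<Rightarrow> 'a \<Rightarrow> bool) \<Rightarrow> 'c set \<Rightarrow> ('c \<Rightarrow> 'c \<Rightarrow> bool) \<Rightarrow> ('a \<Rightarrow> 'c) \<Rightarrow> bool" where
  "monotone_map_between A leA C leC f \<longleftrightarrow> f \<in> A \<rightarrow> C \<and> monotone_on A leA leC f"

definition modular_closure_space ::
  "'a set \<Rightarrow> ('a \<Rightarrow> 'a \<Rightarrow> bool) \<Rightarrow> ('a set \<Rightarrow> 'a set) \<Rightarrow> bool" where
  "modular_closure_space A le cl \<longleftrightarrow>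
     ordered_set A le \<and> closure_space A cl \<and>
     (\<forall>x\<in>A. \<forall>y\<in>A. le x y \<longrightarrow> y \<in> cl {x})"

definition normalised ::
  "'a set \<Rightarrow> ('a \<Rightarrow> 'a \<Rightarrow> bool) \<Rightarrow> ('a set \<Rightarrow> 'a set) \<Rightarrow> bool" where
  "normalised A le cl \<longleftrightarrow>
     modular_closure_space A le cl \<and> (\<forall>x\<in>A. \<forall>y\<in>A. le x y \<longleftrightarrow> y \<in> cl {x})"

text \<open>
  Families of closed subsets are represented by their sets of members; repetitions do not affect
  the intersections. The empty subfamily is allowed: its intersection is \<open>UNIV\<close>, so that
  \<open>S \<inter> \<Inter>{} = S\<close>, as with the convention that the empty intersection is the carrier \<open>A\<close>.
\<close>

definition compact_subset :: "'a set \<Rightarrow> ('a set \<Rightarrow> 'a set) \<Rightarrow> 'a set \<Rightarrow> bool" where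
  "compact_subset A cl S \<longleftrightarrow>
     S \<subseteq> A \<and>
     (\<forall>\<V>. (\<forall>V\<in>\<V>. closed_subset A cl V) \<longrightarrow>
          (\<forall>\<F>. finite \<F> \<and> \<F> \<subseteq> \<V> \<longrightarrow> S \<inter> \<Inter>\<F> \<noteq> {}) \<longrightarrow>
          S \<inter> \<Inter>\<V> \<noteq> {})"

definition up_directed :: "'a set \<Rightarrow> ('a \<Rightarrow> 'a \<Rightarrow> bool) \<Rightarrow> 'a set \<Rightarrow> bool" where
  "up_directed A le S \<longleftrightarrow>
     S \<subseteq> A \<and> S \<noteq> {} \<and>
     (\<forall>F. finite F \<and> F \<subseteq> S \<longrightarrow> (\<exists>u\<in>S. \<forall>x\<in>F. le x u))"

definition left_kan_extension ::
  "'a set \<Rightarrow> 'b set \<Rightarrow> ('b \<Rightarrow> 'b \<Rightarrow> bool) \<Rightarrow> 'm set \<Rightarrow> ('m \<Rightarrow> 'm \<Rightarrow> bool) \<Rightarrow>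
   ('a \<Rightarrow> 'm) \<Rightarrow> ('a \<times> 'b) set \<Rightarrow> ('b \<Rightarrow> 'm) \<Rightarrow> bool" where
  "left_kan_extension A B leB M leM d J l \<longleftrightarrow>
     monotone_map_between B leB M leM l \<and>
     (\<forall>y\<in>B. \<forall>z\<in>M. leM (l y) z \<longleftrightarrow> (\<forall>x\<in>preimage_at A J y. leM (d x) z))"

definition beck_chevalley ::
  "'a set \<Rightarrow> 'b set \<Rightarrow> 'm set \<Rightarrow> ('m \<Rightarrow> 'm \<Rightarrow> bool) \<Rightarrow>
   ('a \<Rightarrow> 'm) \<Rightarrow> ('a \<times> 'b) set \<Rightarrow> ('b \<Rightarrow> 'm) \<Rightarrow> bool" where
  "beck_chevalley A B M leM d J l \<longleftrightarrow>
     (\<forall>z\<in>M. \<forall>y\<in>B. leM z (l y) \<longleftrightarrow> (\<exists>x\<in>preimage_at A J y. leM z (d x)))"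

end

theory Submission
  imports Defs
begin

text \<open>
  In a normalised space the closure of a point \<open>s\<close> is its principal up-set
  \<open>{t. s \<le> t}\<close>, so the upper bounds of a set \<open>D\<close> form an intersection of closed
  sets. If \<open>D\<close> is up-directed, the up-sets of finitely many of its points meet in \<open>D\<close>;
  if \<open>D\<close> is also compact, then those of all its points do, and a point of \<open>D\<close> in their
  intersection is a greatest element of \<open>D\<close>
  (\<open>compact_up_directed_has_greatest\<close>). For \<open>D = d(J\<^sup>\<circ>y)\<close> the supremum
  \<open>l y\<close> lies below that greatest element and is therefore attained, which is the
  Beck--Chevalley condition.
\<close>

lemma closed_subset_closure:
  assumes "closure_space A cl" and "S \<subseteq> A"
  shows "closed_subset A cl (cl S)"
proof -
  have "cl S \<in> Pow A"
    using assms by (intro funcset_mem[of cl "Pow A" "Pow A"]) (simp_all add: closure_space_def)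
  then show ?thesis
    using assms by (simp add: closure_space_def closed_subset_def)
qed

text \<open>
  The argument is the one by which a non-empty compact set of reals has a maximum, with
  directedness in place of a total order: an upper bound in \<open>D\<close> of finitely many
  points of \<open>D\<close> lies in each of their closed up-sets \<open>cl {s}\<close>, and compactness
  passes from finitely many points to all of them.
\<close>

lemma compact_up_directed_has_greatest:
  assumes norm: "normalised M le cl"
    and compact: "compact_subset M cl D"
    and directed: "up_directed M le D"
  obtains m where "m \<in> D" and "\<And>s. s \<in> D \<Longrightarrow> le s m"
proof -
  have space: "closure_space M cl"
    using norm unfolding normalised_def modular_closure_space_def by blast
  have up_set: "le s t \<longleftrightarrow> t \<in> cl {s}" if "s \<in> M" "t \<in> M" for s t
    using norm that unfolding normalised_def by blast
  have DM: "D \<subseteq> M"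
    using directed unfolding up_directed_def by blast
  let ?\<V> = "(\<lambda>s. cl {s}) ` D"
  have closed: "\<forall>V\<in>?\<V>. closed_subset M cl V"
    using closed_subset_closure[OF space] DM by blast
  have fip: "D \<inter> \<Inter>\<F> \<noteq> {}" if "finite \<F>" "\<F> \<subseteq> ?\<V>" for \<F>
  proof -
    obtain F where F: "F \<subseteq> D" "finite F" and \<F>: "\<F> = (\<lambda>s. cl {s}) ` F"
      using finite_subset_image[OF \<open>finite \<F>\<close> \<open>\<F> \<subseteq> ?\<V>\<close>] by blast
    obtain u where "u \<in> D" and "\<forall>s\<in>F. le s u"
      using directed F unfolding up_directed_def by blast
    then have "u \<in> cl {s}" if "s \<in> F" for s
      using up_set[of s u] F(1) DM that by (meson subsetD)
    then have "u \<in> D \<inter> \<Inter>\<F>"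
      using \<open>u \<in> D\<close> unfolding \<F> by simp
    then show ?thesis by blast
  qed
  have "D \<inter> \<Inter>?\<V> \<noteq> {}"
    using compact[unfolded compact_subset_def, THEN conjunct2, rule_format, of ?\<V>] closed fip
    by (metis (no_types, lifting))
  then obtain m where "m \<in> D" and "\<forall>s\<in>D. m \<in> cl {s}"
    by blast
  then show thesis
    using that up_set DM by (meson subsetD)
qed

theorem theorem8p1:
  fixes A :: "'a set" and leA :: "'a \<Rightarrow> 'a \<Rightarrow> bool" and clA :: "'a set \<Rightarrow> 'a set"
    and M :: "'m set" and leM :: "'m \<Rightarrow> 'm \<Rightarrow> bool" and clM :: "'m set \<Rightarrow> 'm set"
    and B :: "'b set" and leB :: "'b \<Rightarrow> 'b \<Rightarrow> bool"
    and d :: "'a \<Rightarrow> 'm" and J :: "('a \<times> 'b) set" and l :: "'b \<Rightarrow> 'm"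
  assumes "modular_closure_space A leA clA"
    and "modular_closure_space M leM clM"
    and "monotone_map_between A leA M leM d"
    and "continuous_map_between A clA M clM d"
    and "ordered_set B leB"
    and "modular_relation A leA B leB J"
    and "left_kan_extension A B leB M leM d J l"
    and "normalised M leM clM"
    and "\<And>y. y \<in> B \<Longrightarrow> compact_subset M clM (d ` preimage_at A J y)"
    and "\<And>y. y \<in> B \<Longrightarrow> up_directed M leM (d ` preimage_at A J y)"
  shows "beck_chevalley A B M leM d J l"
proof -
  have "ordered_set M leM"
    using assms(2) by (simp add: modular_closure_space_def)
  then have reflM: "reflp_on M leM" and transM: "transp_on M leM"
    by (simp_all add: ordered_set_def)
  have refl: "leM z z" if "z \<in> M" for z
    using reflM that by (rule reflp_onD)
  have trans: "leM u w" if "leM u v" "leM v w" "u \<in> M" "v \<in> M" "w \<in> M" for u v w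
    using transM that(3-5,1,2) by (rule transp_onD)
  have dM: "d x \<in> M" if "x \<in> preimage_at A J y" for x y
    using assms(3) that by (auto simp: monotone_map_between_def preimage_at_def)
  have lM: "l y \<in> M" if "y \<in> B" for y
    using assms(7) that by (auto simp: left_kan_extension_def monotone_map_between_def)
  have sup: "leM (l y) z \<longleftrightarrow> (\<forall>x\<in>preimage_at A J y. leM (d x) z)"
    if "y \<in> B" "z \<in> M" for y z
    using assms(7) that by (simp add: left_kan_extension_def)
  have "leM z (l y) \<longleftrightarrow> (\<exists>x\<in>preimage_at A J y. leM z (d x))"
    if z: "z \<in> M" and y: "y \<in> B" for z y
  proof
    assume below: "leM z (l y)"
    obtain m where "m \<in> d ` preimage_at A J y"
      and greatest: "\<And>s. s \<in> d ` preimage_at A J y \<Longrightarrow> leM s m"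
      using compact_up_directed_has_greatest[OF assms(8) assms(9)[OF y] assms(10)[OF y]] by blast
    then obtain x where x: "x \<in> preimage_at A J y" and m: "m = d x"
      by blast
    have "leM (l y) (d x)"
      using sup[OF y dM[OF x]] greatest m by blast
    then have "leM z (d x)"
      by (rule trans[OF below _ z lM[OF y] dM[OF x]])
    then show "\<exists>x\<in>preimage_at A J y. leM z (d x)"
      using x by blast
  next
    assume "\<exists>x\<in>preimage_at A J y. leM z (d x)"
    then obtain x where x: "x \<in> preimage_at A J y" and below: "leM z (d x)"
      by blast
    have "leM (d x) (l y)"
      using sup[OF y lM[OF y]] refl[OF lM[OF y]] x by blast
    then show "leM z (l y)"
      by (rule trans[OF below _ z dM[OF x] lM[OF y]])
  qed
  then show ?thesis
    unfolding beck_chevalley_def by blast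
qed

end
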